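(* For each integer $N\ge 1$ let $\mathcal S_N:\mathcal H^\infty\to\mathcal H^\infty$ be the $N$-th partial sum operator on the space $\mathcal H^\infty$ of bounded Dirichlet series, and let $\|\mathcal S_N\|_{\mathcal H^\infty\to\mathcal H^\infty}$ be its operator norm. Then $$\liminf_{N\to\infty}\frac{\|\mathcal S_N\|_{\mathcal H^\infty\to\mathcal H^\infty}}{\log N}\ \ge\ \frac{1}{2\pi}.$$ In particular (in combination with the known upper estimate $\|\mathcal S_N\|_{\mathcal H^\infty\to\mathcal H^\infty}\lesssim\log N$ of Balasubramanian, Calado and Queffélec), $$\|\mathcal S_N\|_{\mathcal H^\infty\to\mathcal H^\infty}\asymp\log N,$$ that is, there exist constants $0<c\le C<\infty$ such that $c\log N\le\|\mathcal S_N\|_{\mathcal H^\infty\to\mathcal H^\infty}\le C\log N$ for all sufficiently large $N$.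
   Context: For $\sigma\in\mathbb R$ let $\mathbb C_\sigma=\{s\in\mathbb C:\operatorname{Re}s>\sigma\}$. The space $\mathcal H^\infty$ consists of all bounded holomorphic functions $f$ on $\mathbb C_0$ for which there exist $\sigma>0$ and complex coefficients $(a_n)_{n\ge1}$ such that the Dirichlet series $\sum_{n=1}^\infty a_n n^{-s}$ converges on $\mathbb C_\sigma$ and represents $f$ there. The norm is $\|f\|_{\mathcal H^\infty}=\sup_{s\in\mathbb C_0}|f(s)|$. The coefficients $(a_n)$ are uniquely determined by $f$. The $N$-th partial sum operator is $\mathcal S_N f(s)=\sum_{n=1}^N a_n n^{-s}$ for $f(s)=\sum_{n=1}^\infty a_n n^{-s}$ in $\mathcal H^\infty$, and $\|\mathcal S_N\|_{\mathcal H^\infty\to\mathcal H^\infty}=\sup\{\|\mathcal S_Nf\|_{\mathcal H^\infty}: f\in\mathcal H^\infty,\ \|f\|_{\mathcal H^\infty}\le1\}$. The notation $X_N\lesssim Y_N$ means $X_N\le C\,Y_N$ with a constant $C$ independent of (large) $N$. *)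

theory Defs
  imports "HOL-Complex_Analysis.Complex_Analysis"
begin

definition half_plane :: "real \<Rightarrow> complex set" where
  "half_plane \<sigma> = {s. \<sigma> < Re s}"

text \<open>
  The series \<open>\<Sum>n\<ge>1. a n * n powr (-s)\<close> converges, possibly only conditionally, to \<open>f s\<close> on some
  half-plane. The value \<open>a 0\<close> plays no role.
\<close>

definition dirichlet_rep :: "(nat \<Rightarrow> complex) \<Rightarrow> (complex \<Rightarrow> complex) \<Rightarrow> bool" where
  "dirichlet_rep a f \<longleftrightarrow>
     (\<exists>\<sigma>>0. \<forall>s\<in>half_plane \<sigma>. (\<lambda>n. a (Suc n) * of_nat (Suc n) powr (-s)) sums f s)"

text \<open>
  Members are total functions on \<open>\<complex>\<close>; their values outside \<open>half_plane 0\<close> are irrelevant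
  to everything below.
\<close>

definition Hinf :: "(complex \<Rightarrow> complex) set" where
  "Hinf = {f. f holomorphic_on half_plane 0 \<and> bounded (f ` half_plane 0) \<and> (\<exists>a. dirichlet_rep a f)}"

text \<open>
  Norms take values in the extended reals, so that no supremum below needs a finiteness
  side condition.
\<close>

definition Hinf_norm :: "(complex \<Rightarrow> complex) \<Rightarrow> ereal" where
  "Hinf_norm f = (SUP s\<in>half_plane 0. ereal (norm (f s)))"

text \<open>
  For \<open>f \<in> Hinf\<close> the coefficients with index \<open>n \<ge> 1\<close> are uniquely determined by \<open>f\<close>, so the
  choice only affects the unused index \<open>0\<close>.
\<close>

definition dirichlet_coeff :: "(complex \<Rightarrow> complex) \<Rightarrow> nat \<Rightarrow> complex" where
  "dirichlet_coeff f = (SOME a. dirichlet_rep a f)"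

definition partial_sum_op :: "nat \<Rightarrow> (complex \<Rightarrow> complex) \<Rightarrow> complex \<Rightarrow> complex" where
  "partial_sum_op N f s = (\<Sum>n=1..N. dirichlet_coeff f n * of_nat n powr (-s))"

definition Hinf_opnorm :: "((complex \<Rightarrow> complex) \<Rightarrow> complex \<Rightarrow> complex) \<Rightarrow> ereal" where
  "Hinf_opnorm T = (SUP f\<in>{f \<in> Hinf. Hinf_norm f \<le> 1}. Hinf_norm (T f))"

end

theory Submission
  imports Defs "HOL-Probability.Sinc_Integral" "HOL-Real_Asymp.Real_Asymp"
begin

text \<open>
  The two bounds rest on different ideas.

  Upper bound. Convolving \<open>f\<close> along vertical lines with an integrable kernel \<open>K\<close> multiplies the \<open>n\<close>-th
  coefficient by the Fourier transform of \<open>K\<close> at \<open>ln n\<close>, and costs at most the factor \<open>\<parallel>K\<parallel>\<^sub>1\<close> in norm.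
  A trapezoid that equals \<open>1\<close> up to \<open>ln N\<close> and \<open>0\<close> from \<open>ln (N + 1)\<close> on reproduces the sharp cutoff at
  \<open>N\<close>, because no integer lies between \<open>N\<close> and \<open>N + 1\<close>. Although the slope is as steep as \<open>N\<close>, the
  \<open>L\<^sup>1\<close> norm of this kernel grows only logarithmically (\<open>vp_kernel_L1_bound\<close>). The identity between the
  partial sum and the convolution is checked far to the right, where everything converges absolutely,
  and carried to the whole half-plane by analytic continuation (\<open>partial_sum_eq_vertical_average\<close>). It also
  shows that the partial sums depend on \<open>f\<close> only.

  Lower bound. Triangular truncation of the \<open>M \<times> M\<close> matrix \<open>1/(j - i)\<close>, \<open>i \<noteq> j\<close>, raises the value of the associated
  bilinear form, over vectors with entries in the unit disc, from at most \<open>\<pi> M\<close> (Hilbert's inequality,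
  \<open>hilbert_inequality\<close>) to at least \<open>M (ln M - 1)\<close> (\<open>truncated_hilbert_sum\<close>). For \<open>M \<le> \<surd>N\<close> this truncation is a partial sum of
  a Dirichlet polynomial: give the entry \<open>(i, j)\<close> the frequency \<open>i \<lfloor>N/j\<rfloor>\<close>; then \<open>i \<lfloor>N/j\<rfloor> \<le> N\<close> holds exactly
  when \<open>i \<le> j\<close> (\<open>hyperbola_truncation_iff\<close>). The norm of this polynomial is bounded by estimating the form pointwise, and its partial sum is
  evaluated at \<open>s \<rightarrow> 0\<close>, where all terms are positive; coincidences among the frequencies do no harm to either.
  With \<open>M = \<lfloor>\<surd>N\<rfloor>\<close> the gain is \<open>(ln M - 1)/\<pi> \<sim> ln N / (2\<pi>)\<close>.
\<close>

section \<open>The de la Vallee Poussin kernel\<close>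

text \<open>
  Integrating by parts reduces this to the Dirichlet integral \<open>\<integral>\<^sub>0\<^sup>\<infinity> sin t / t dt = \<pi>/2\<close>.
\<close>

lemma one_minus_cos_div_square_integral_pos:
  fixes a :: real
  assumes "a > 0"
  shows "set_integrable lborel {0<..} (\<lambda>t. (1 - cos (a * t)) / t\<^sup>2)"
    and "(LINT t:{0<..}|lborel. (1 - cos (a * t)) / t\<^sup>2) = pi * a / 2"
proof -
  define F where "F = (\<lambda>t. a * Si (a * t) - (1 - cos (a * t)) / t)"
  have D: "DERIV F t :> (1 - cos (a * t)) / t\<^sup>2" if "t > 0" for t
  proof -
    have "((\<lambda>t. Si (a * t)) has_real_derivative sinc (a * t) * a) (at t)"
      by (rule DERIV_chain2[OF DERIV_Si]) (auto intro!: derivative_eq_intros)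
    then show ?thesis
      unfolding F_def using that assms
      by (auto intro!: derivative_eq_intros simp: field_simps power2_eq_square)
  qed
  have Si0: "Si 0 = 0"
    by (simp add: Si_def zero_ereal_def)
  have A: "((F \<circ> real_of_ereal) \<longlongrightarrow> 0) (at_right 0)"
  proof -
    have "((\<lambda>t. a * Si (a * t) - (1 - cos (a * t)) / t) \<longlongrightarrow> a * Si (a * 0) - 0) (at_right 0)"
    proof (intro tendsto_intros)
      show "((\<lambda>t. Si (a * t)) \<longlongrightarrow> Si (a * 0)) (at_right 0)"
        by (rule isCont_tendsto_compose[OF isCont_Si]) (auto intro!: tendsto_eq_intros)
      show "((\<lambda>t. (1 - cos (a * t)) / t) \<longlongrightarrow> 0) (at_right 0)"
        by real_asymp
    qed
    then show ?thesis
      unfolding zero_ereal_def ereal_tendsto_simps using Si0 by (simp add: F_def)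
  qed
  have B: "((F \<circ> real_of_ereal) \<longlongrightarrow> a * (pi / 2)) (at_left \<infinity>)"
  proof -
    have "((\<lambda>t. a * Si (a * t) - (1 - cos (a * t)) / t) \<longlongrightarrow> a * (pi / 2) - 0) at_top"
    proof (intro tendsto_intros)
      show "((\<lambda>t. Si (a * t)) \<longlongrightarrow> pi / 2) at_top"
        by (rule filterlim_compose[OF Si_at_top]) (use assms in real_asymp)
      show "((\<lambda>t. (1 - cos (a * t)) / t) \<longlongrightarrow> 0) at_top"
        by real_asymp
    qed
    then show ?thesis
      unfolding ereal_tendsto_simps by (simp add: F_def)
  qed
  have C: "isCont (\<lambda>t. (1 - cos (a * t)) / t\<^sup>2) t" if "t > 0" for t
    using that by (auto intro!: continuous_intros)
  have e: "einterval 0 \<infinity> = {0<..}"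
    by (auto simp: einterval_def zero_ereal_def)
  have *: "set_integrable lborel (einterval 0 \<infinity>) (\<lambda>t. (1 - cos (a * t)) / t\<^sup>2)"
     "(LBINT t=0..\<infinity>. (1 - cos (a * t)) / t\<^sup>2) = a * (pi / 2) - 0"
    by (rule interval_integral_FTC_nonneg[where F = F]; use A B C D in \<open>simp add: zero_ereal_def\<close>)+
  show "set_integrable lborel {0<..} (\<lambda>t. (1 - cos (a * t)) / t\<^sup>2)"
    using *(1) e by simp
  show "(LINT t:{0<..}|lborel. (1 - cos (a * t)) / t\<^sup>2) = pi * a / 2"
    using *(2) by (simp add: interval_lebesgue_integral_0_infty)
qed

lemma one_minus_cos_div_square_integral:
  fixes a :: real
  shows "set_integrable lborel {0<..} (\<lambda>t. (1 - cos (a * t)) / t\<^sup>2)"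
    and "(LINT t:{0<..}|lborel. (1 - cos (a * t)) / t\<^sup>2) = pi * \<bar>a\<bar> / 2"
proof -
  consider "a > 0" | "a = 0" | "- a > 0" by linarith
  then have "set_integrable lborel {0<..} (\<lambda>t. (1 - cos (a * t)) / t\<^sup>2) \<and>
    (LINT t:{0<..}|lborel. (1 - cos (a * t)) / t\<^sup>2) = pi * \<bar>a\<bar> / 2"
  proof cases
    case 1 then show ?thesis using one_minus_cos_div_square_integral_pos[of a] by simp
  next
    case 2 then show ?thesis by (simp add: set_integrable_def)
  next
    case 3 then show ?thesis using one_minus_cos_div_square_integral_pos[of "-a"] by simp
  qed
  then show "set_integrable lborel {0<..} (\<lambda>t. (1 - cos (a * t)) / t\<^sup>2)"
    and "(LINT t:{0<..}|lborel. (1 - cos (a * t)) / t\<^sup>2) = pi * \<bar>a\<bar> / 2" by auto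
qed

text \<open>
  The de la Vallee Poussin kernel: its Fourier transform is the trapezoid equal to \<open>1\<close> on \<open>[-A, A]\<close>,
  vanishing outside \<open>[-B, B]\<close> and linear in between.
\<close>

definition vp_kernel :: "real \<Rightarrow> real \<Rightarrow> real \<Rightarrow> real" where
  "vp_kernel A B t = (cos (A * t) - cos (B * t)) / (pi * (B - A) * t\<^sup>2)"

lemma vp_kernel_integrable: "set_integrable lborel {0<..} (vp_kernel A B)"
proof -
  have "set_integrable lborel {0<..}
     (\<lambda>t. ((1 - cos (B * t)) / t\<^sup>2 - (1 - cos (A * t)) / t\<^sup>2) / (pi * (B - A)))"
    using one_minus_cos_div_square_integral(1) by (intro set_integrable_divide set_integral_diff(1)) auto
  also have "(\<lambda>t. ((1 - cos (B * t)) / t\<^sup>2 - (1 - cos (A * t)) / t\<^sup>2) / (pi * (B - A))) = vp_kernel A B"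
    by (auto simp: vp_kernel_def fun_eq_iff diff_divide_distrib[symmetric] mult.commute)
  finally show ?thesis .
qed

text \<open>
  The trapezoid is the second difference \<open>(\<bar>B + x\<bar> + \<bar>B - x\<bar> - \<bar>A + x\<bar> - \<bar>A - x\<bar>) / (2 (B - A))\<close>;
  each absolute value is a cosine integral as above. The gap \<open>A < x < B\<close> is excluded because the
  kernel will only be tested at frequencies \<open>ln n\<close>, none of which lies there.
\<close>

lemma vp_kernel_cos_integral:
  assumes "0 \<le> A" "A < B" "0 \<le> x" "x \<le> A \<or> B \<le> x"
  shows "set_integrable lborel {0<..} (\<lambda>t. 2 * cos (x * t) * vp_kernel A B t)"
    and "(LINT t:{0<..}|lborel. 2 * cos (x * t) * vp_kernel A B t) = (if x \<le> A then 1 else 0)"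
proof -
  define h where "h = (\<lambda>a t::real. (1 - cos (a * t)) / t\<^sup>2)"
  define c where "c = 1 / (pi * (B - A))"
  have h: "set_integrable lborel {0<..} (h a)" "(LINT t:{0<..}|lborel. h a t) = pi * \<bar>a\<bar> / 2" for a
    using one_minus_cos_div_square_integral[of a] by (auto simp: h_def)
  have id: "2 * cos (x * t) * (cos (A * t) - cos (B * t)) =
     (1 - cos ((B + x) * t)) + (1 - cos ((B - x) * t)) - (1 - cos ((A + x) * t)) - (1 - cos ((A - x) * t))" for t
    by (simp add: ring_distribs cos_add cos_diff)
  have eq: "(\<lambda>t. 2 * cos (x * t) * vp_kernel A B t) =
     (\<lambda>t. c * (h (B + x) t + h (B - x) t - h (A + x) t - h (A - x) t))"
  proof
    fix t
    have "2 * cos (x * t) * vp_kernel A B t = (2 * cos (x * t) * (cos (A * t) - cos (B * t))) * c / t\<^sup>2"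
      by (simp add: vp_kernel_def c_def)
    also have "\<dots> = c * (h (B + x) t + h (B - x) t - h (A + x) t - h (A - x) t)"
      unfolding id h_def by (simp add: diff_divide_distrib add_divide_distrib algebra_simps)
    finally show "2 * cos (x * t) * vp_kernel A B t = c * (h (B + x) t + h (B - x) t - h (A + x) t - h (A - x) t)" .
  qed
  show "set_integrable lborel {0<..} (\<lambda>t. 2 * cos (x * t) * vp_kernel A B t)"
    unfolding eq by (intro set_integrable_mult_right set_integral_add(1) set_integral_diff(1) h)
  have "(LINT t:{0<..}|lborel. 2 * cos (x * t) * vp_kernel A B t) =
      c * (pi * \<bar>B + x\<bar> / 2 + pi * \<bar>B - x\<bar> / 2 - pi * \<bar>A + x\<bar> / 2 - pi * \<bar>A - x\<bar> / 2)"
    unfolding eq by (simp add: set_integral_add set_integral_diff h)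
  also have "\<dots> = (if x \<le> A then 1 else 0)"
    using assms by (auto simp: c_def field_simps)
  finally show "(LINT t:{0<..}|lborel. 2 * cos (x * t) * vp_kernel A B t) = (if x \<le> A then 1 else 0)" .
qed

lemma abs_cos_diff_le:
  fixes A B t :: real
  assumes "0 \<le> A" "A < B" "0 \<le> t"
  shows "\<bar>cos (A * t) - cos (B * t)\<bar> \<le> 2"
    and "\<bar>cos (A * t) - cos (B * t)\<bar> \<le> (B - A) * t"
    and "\<bar>cos (A * t) - cos (B * t)\<bar> \<le> (A + B) / 2 * (B - A) * t\<^sup>2"
proof -
  show "\<bar>cos (A * t) - cos (B * t)\<bar> \<le> 2"
    using cos_le_one[of "A*t"] cos_le_one[of "B*t"] cos_ge_minus_one[of "A*t"] cos_ge_minus_one[of "B*t"]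
    by linarith
  define u v where "u = (A * t + B * t) / 2" and "v = (B * t - A * t) / 2"
  have pos: "u \<ge> 0" "v \<ge> 0"
    using assms mult_right_mono[of A B t] by (auto simp: u_def v_def)
  have eq: "\<bar>cos (A * t) - cos (B * t)\<bar> = 2 * \<bar>sin u\<bar> * \<bar>sin v\<bar>"
    unfolding cos_diff_cos u_def v_def by (simp add: abs_mult)
  have s: "\<bar>sin u\<bar> \<le> u" "\<bar>sin u\<bar> \<le> 1" "\<bar>sin v\<bar> \<le> v"
    using abs_sin_x_le_abs_x[of u] abs_sin_x_le_abs_x[of v] pos by auto
  have "\<bar>sin u\<bar> * \<bar>sin v\<bar> \<le> 1 * v" "\<bar>sin u\<bar> * \<bar>sin v\<bar> \<le> u * v"
    by (intro mult_mono; use s pos in auto)+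
  then show "\<bar>cos (A * t) - cos (B * t)\<bar> \<le> (B - A) * t"
    and "\<bar>cos (A * t) - cos (B * t)\<bar> \<le> (A + B) / 2 * (B - A) * t\<^sup>2"
    unfolding eq by (simp_all add: u_def v_def algebra_simps power2_eq_square)
qed

text \<open>
  A majorant with an explicit integral for \<open>min (1/t) (M/t\<^sup>2)\<close>: the minimum of two positive numbers is at
  most their harmonic mean, here \<open>2 M / (t (t + M))\<close>.
\<close>

lemma integral_inverse_mult_tail:
  fixes M :: real
  assumes "M > 0"
  shows "set_integrable lborel {1<..} (\<lambda>t. 2 * M / (t * (t + M)))"
    and "(LINT t:{1<..}|lborel. 2 * M / (t * (t + M))) = 2 * ln (1 + M)"
proof -
  define F where "F = (\<lambda>t. 2 * (ln t - ln (t + M)))"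
  have D: "DERIV F t :> 2 * M / (t * (t + M))" if "t > 1" for t
    unfolding F_def using that assms
    by (auto intro!: derivative_eq_intros simp: divide_simps)
  have A: "((F \<circ> real_of_ereal) \<longlongrightarrow> 2 * (ln 1 - ln (1 + M))) (at_right (ereal 1))"
  proof -
    have "((\<lambda>t. 2 * (ln t - ln (t + M))) \<longlongrightarrow> 2 * (ln 1 - ln (1 + M))) (at_right 1)"
      using assms by (intro tendsto_intros) auto
    then show ?thesis unfolding ereal_tendsto_simps by (simp add: F_def)
  qed
  have B: "((F \<circ> real_of_ereal) \<longlongrightarrow> 0) (at_left \<infinity>)"
  proof -
    have "((\<lambda>t. 2 * (ln t - ln (t + M))) \<longlongrightarrow> 0) at_top"
      using assms by real_asymp
    then show ?thesis unfolding ereal_tendsto_simps by (simp add: F_def)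
  qed
  have C: "isCont (\<lambda>t. 2 * M / (t * (t + M))) t" if "t > 1" for t
    using that assms by (auto intro!: continuous_intros)
  have e: "einterval (ereal 1) \<infinity> = {1<..}"
    by (auto simp: einterval_def)
  have *: "set_integrable lborel (einterval (ereal 1) \<infinity>) (\<lambda>t. 2 * M / (t * (t + M)))"
     "(LBINT t=ereal 1..\<infinity>. 2 * M / (t * (t + M))) = 0 - 2 * (ln 1 - ln (1 + M))"
    by (rule interval_integral_FTC_nonneg[where F = F]; use A B C D assms in simp)+
  show "set_integrable lborel {1<..} (\<lambda>t. 2 * M / (t * (t + M)))"
    using *(1) e by simp
  show "(LINT t:{1<..}|lborel. 2 * M / (t * (t + M))) = 2 * ln (1 + M)"
    using *(2) e by (simp add: interval_lebesgue_integral_def)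
qed

text \<open>
  For \<open>A = ln N\<close> and \<open>B = ln (N + 1)\<close> both terms are of order \<open>ln N\<close>. The kernel is at most
  \<open>(A + B) / (2\<pi>)\<close> everywhere; on \<open>t > 1\<close> it is bounded both by \<open>1/t\<close> and by \<open>2 / ((B - A) t\<^sup>2)\<close>, up to the factor
  \<open>1/\<pi>\<close>, and the change from one bound to the other at \<open>t = 2 / (B - A)\<close> gives the logarithm.
\<close>

lemma vp_kernel_L1_bound:
  assumes "0 \<le> A" "A < B"
  shows "(LINT t:{0<..}|lborel. \<bar>vp_kernel A B t\<bar>) \<le> ((A + B) / 2 + 2 * ln (1 + 2 / (B - A))) / pi"
proof -
  define M where "M = 2 / (B - A)"
  have M: "M > 0" using assms by (simp add: M_def)
  have int: "set_integrable lborel {0<..} (\<lambda>t. \<bar>vp_kernel A B t\<bar>)"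
    by (rule set_integrable_abs[OF vp_kernel_integrable])
  have i1: "set_integrable lborel {0<..1} (\<lambda>t. \<bar>vp_kernel A B t\<bar>)"
   and i2: "set_integrable lborel {1<..} (\<lambda>t. \<bar>vp_kernel A B t\<bar>)"
    by (rule set_integrable_subset[OF int]; auto)+
  have b1: "\<bar>vp_kernel A B t\<bar> \<le> (A + B) / 2 / pi" if "t > 0" for t
  proof -
    have "\<bar>vp_kernel A B t\<bar> = \<bar>cos (A * t) - cos (B * t)\<bar> / (pi * (B - A) * t\<^sup>2)"
      using assms by (simp add: vp_kernel_def abs_mult)
    also have "\<dots> \<le> (A + B) / 2 * (B - A) * t\<^sup>2 / (pi * (B - A) * t\<^sup>2)"
      using assms that by (intro divide_right_mono abs_cos_diff_le) auto
    also have "\<dots> = (A + B) / 2 / pi"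
      using assms that by (simp add: field_simps)
    finally show ?thesis .
  qed
  have b2: "\<bar>vp_kernel A B t\<bar> \<le> 2 * M / (t * (t + M)) / pi" if "t > 1" for t
  proof -
    define y where "y = \<bar>cos (A * t) - cos (B * t)\<bar>"
    have y: "y \<le> 2" "y \<le> (B - A) * t"
      unfolding y_def using assms that by (auto intro!: abs_cos_diff_le)
    have MB: "(B - A) * M = 2"
      using assms unfolding M_def by (subst nonzero_mult_div_cancel_left[symmetric, of "B - A" 2]) auto
    \<comment> \<open>the first summand uses \<open>y \<le> 2\<close>, the second \<open>y \<le> (B - A) t\<close>\<close>
    have "y * (t + M) = y * t + y * M"
      by (simp add: algebra_simps)
    also have "\<dots> \<le> 2 * t + ((B - A) * t) * M"
      using y M that by (intro add_mono mult_right_mono) auto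
    also have "\<dots> = 2 * t + ((B - A) * M) * t"
      by (simp add: mult_ac)
    also have "\<dots> = 2 * ((B - A) * M) * t"
      unfolding MB by simp
    also have "\<dots> = 2 * M * (B - A) * t"
      by (simp add: mult_ac)
    finally have "y * (t + M) \<le> 2 * M * (B - A) * t" .
    then have "y / ((B - A) * t\<^sup>2) \<le> 2 * M / (t * (t + M))"
      using assms that M by (simp add: divide_simps power2_eq_square)
    then have "y / ((B - A) * t\<^sup>2) / pi \<le> 2 * M / (t * (t + M)) / pi"
      by (intro divide_right_mono) auto
    moreover have "\<bar>vp_kernel A B t\<bar> = y / ((B - A) * t\<^sup>2) / pi"
      using assms by (simp add: vp_kernel_def abs_mult y_def mult_ac)
    ultimately show ?thesis by simp
  qed
  have U: "{0<..} = {0<..1} \<union> {1::real<..}" by auto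
  have "(LINT t:{0<..}|lborel. \<bar>vp_kernel A B t\<bar>) =
     (LINT t:{0<..1}|lborel. \<bar>vp_kernel A B t\<bar>) + (LINT t:{1<..}|lborel. \<bar>vp_kernel A B t\<bar>)"
    by (subst U, rule set_integral_Un[OF _ i1 i2]) auto
  also have "\<dots> \<le> (LINT t:{0<..1::real}|lborel. (A + B) / 2 / pi) +
      (LINT t:{1<..}|lborel. 2 * M / (t * (t + M)) / pi)"
  proof (intro add_mono set_integral_mono i1 i2)
    show "set_integrable lborel {0<..1::real} (\<lambda>t. (A + B) / 2 / pi)"
      by (simp add: set_integrable_def)
    show "set_integrable lborel {1<..} (\<lambda>t. 2 * M / (t * (t + M)) / pi)"
      by (rule set_integrable_divide) (use integral_inverse_mult_tail(1)[OF M] in simp)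
  qed (use b1 b2 in auto)
  also have "(LINT t:{0<..1::real}|lborel. (A + B) / 2 / pi) = (A + B) / 2 / pi"
    by (simp add: set_lebesgue_integral_def)
  also have "(LINT t:{1<..}|lborel. 2 * M / (t * (t + M)) / pi) = 2 * ln (1 + M) / pi"
    using integral_inverse_mult_tail(2)[OF M] by (subst set_integral_divide_zero) simp
  finally show ?thesis by (simp add: M_def add_divide_distrib)
qed

section \<open>Convolution along vertical lines\<close>

lemma open_half_plane: "open (half_plane \<sigma>)"
  using open_halfspace_Re_gt[of \<sigma>] by (simp add: half_plane_def)

lemma convex_half_plane: "convex (half_plane \<sigma>)"
  using convex_halfspace_Re_gt[of \<sigma>] by (simp add: half_plane_def)

lemma norm_set_integral_mult_le:
  fixes K :: "real \<Rightarrow> real" and g :: "real \<Rightarrow> complex"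
  assumes K: "set_integrable M S K" and Kg: "set_integrable M S (\<lambda>t. of_real (K t) * g t)"
    and g: "\<And>t. t \<in> S \<Longrightarrow> norm (g t) \<le> D"
  shows "norm (LINT t:S|M. of_real (K t) * g t) \<le> D * (LINT t:S|M. \<bar>K t\<bar>)"
proof -
  have "norm (LINT t:S|M. of_real (K t) * g t) \<le> (LINT t|M. norm (indicator S t *\<^sub>R (of_real (K t) * g t)))"
    unfolding set_lebesgue_integral_def by (rule integral_norm_bound)
  also have "\<dots> \<le> (LINT t|M. D * (indicator S t *\<^sub>R \<bar>K t\<bar>))"
  proof (rule integral_mono)
    show "integrable M (\<lambda>t. norm (indicator S t *\<^sub>R (of_real (K t) * g t)))"
      using Kg unfolding set_integrable_def by (rule integrable_norm)
    show "integrable M (\<lambda>t. D * (indicator S t *\<^sub>R \<bar>K t\<bar>))"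
      using set_integrable_abs[OF K] unfolding set_integrable_def by (rule integrable_mult_right)
    show "norm (indicator S t *\<^sub>R (of_real (K t) * g t)) \<le> D * (indicator S t *\<^sub>R \<bar>K t\<bar>)" for t
      using mult_left_mono[OF g[of t], of "\<bar>K t\<bar>"]
      by (auto simp: norm_mult indicator_def mult_ac)
  qed
  also have "\<dots> = D * (LINT t:S|M. \<bar>K t\<bar>)"
    unfolding set_lebesgue_integral_def by simp
  finally show ?thesis .
qed

text \<open>
  For an even kernel this is the convolution of \<open>f\<close> with \<open>K\<close> along the vertical line through \<open>s\<close>. Pairing
  \<open>t\<close> with \<open>-t\<close> keeps all integrals on the half-line, and turns \<open>n\<^bsup>-it\<^esup>\<close> into the real \<open>2 cos (t ln n)\<close>.
\<close>

definition vertical_average :: "(real \<Rightarrow> real) \<Rightarrow> (complex \<Rightarrow> complex) \<Rightarrow> complex \<Rightarrow> complex" where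
  "vertical_average K f s =
     (LINT t:{0<..}|lborel. of_real (K t) * (f (s + \<i> * of_real t) + f (s - \<i> * of_real t)))"

context
  fixes K :: "real \<Rightarrow> real" and f :: "complex \<Rightarrow> complex" and C :: real
  assumes Kcont: "continuous_on {0<..} K" and Kint: "set_integrable lborel {0<..} K"
    and hol: "f holomorphic_on half_plane 0"
    and bdd: "\<And>s. s \<in> half_plane 0 \<Longrightarrow> norm (f s) \<le> C"
begin

private lemma vertical_pair_bound:
  assumes "s \<in> half_plane 0"
  shows "norm (f (s + \<i> * of_real t) + f (s - \<i> * of_real t)) \<le> 2 * C"
proof -
  have "norm (f (s + \<i> * of_real t)) \<le> C" "norm (f (s - \<i> * of_real t)) \<le> C"
    using assms by (auto intro!: bdd simp: half_plane_def)
  then show ?thesis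
    using norm_triangle_ineq[of "f (s + \<i> * of_real t)" "f (s - \<i> * of_real t)"] by linarith
qed

private lemma vertical_integrable:
  assumes "s \<in> half_plane 0"
  shows "set_integrable lborel {0<..} (\<lambda>t. of_real (K t) * (f (s + \<i> * of_real t) + f (s - \<i> * of_real t)))"
proof (rule set_integrable_bound)
  show "set_integrable lborel {0<..} (\<lambda>t. (2 * C) * K t)"
    using Kint by (rule set_integrable_mult_right)
  have cf: "continuous_on (half_plane 0) f"
    using hol by (rule holomorphic_on_imp_continuous_on)
  have "continuous_on {0<..} (\<lambda>t. of_real (K t) * (f (s + \<i> * of_real t) + f (s - \<i> * of_real t)))"
    using assms
    by (intro continuous_intros Kcont continuous_on_compose2[OF cf]) (auto simp: half_plane_def)
  from set_measurable_continuous_on[OF _ this]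
  show "set_borel_measurable lborel {0<..} (\<lambda>t. of_real (K t) * (f (s + \<i> * of_real t) + f (s - \<i> * of_real t)))"
    by (simp add: set_borel_measurable_def)
  have C: "C \<ge> 0" using bdd[OF assms] norm_ge_zero order_trans by blast
  have "norm (of_real (K t) * (f (s + \<i> * of_real t) + f (s - \<i> * of_real t))) \<le> norm (2 * C * K t)" for t
    using mult_left_mono[OF vertical_pair_bound[OF assms, of t], of "\<bar>K t\<bar>"] C
    by (simp add: norm_mult abs_mult mult_ac)
  then show "AE t in lborel. t \<in> {0<..} \<longrightarrow>
      norm (of_real (K t) * (f (s + \<i> * of_real t) + f (s - \<i> * of_real t))) \<le> norm (2 * C * K t)"
    by simp
qed

lemma norm_vertical_average_le:
  assumes "s \<in> half_plane 0"
  shows "norm (vertical_average K f s) \<le> 2 * C * (LINT t:{0<..}|lborel. \<bar>K t\<bar>)"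
  unfolding vertical_average_def
  by (rule norm_set_integral_mult_le[OF Kint vertical_integrable[OF assms] vertical_pair_bound[OF assms]])

text \<open>
  The integrals over the compact intervals \<open>[1/(n+1), n+1]\<close> are holomorphic by differentiation under the
  integral sign. Since \<open>K\<close> is integrable and \<open>f\<close> bounded, they converge uniformly. The intervals avoid
  \<open>0\<close> because the kernel is only assumed continuous on the open half-line.
\<close>

lemma vertical_average_holomorphic: "vertical_average K f holomorphic_on half_plane 0"
proof -
  define g where "g = (\<lambda>s t. of_real (K t) * (f (s + \<i> * of_real t) + f (s - \<i> * of_real t)))"
  define A where "A = (\<lambda>n. {1 / (real n + 1)..real n + 1})"
  define G where "G = (\<lambda>n s. integral (A n) (g s))"
  have Apos: "A n \<subseteq> {0<..}" for n
  proof -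
    have "0 < 1 / (real n + 1)" by simp
    from less_le_trans[OF this] show ?thesis unfolding A_def by auto
  qed
  have Aset: "A n \<in> sets lborel" for n by (simp add: A_def)
  have Aincr: "incseq A"
  proof (unfold incseq_def, intro allI impI)
    fix m n :: nat assume "m \<le> n"
    then have "1 / (real n + 1) \<le> 1 / (real m + 1)" "real m + 1 \<le> real n + 1"
      by (auto intro!: frac_le)
    then show "A m \<subseteq> A n" unfolding A_def by auto
  qed
  have AU: "(\<Union>n. A n) = {0<..}"
  proof
    show "(\<Union>n. A n) \<subseteq> {0<..}" using Apos by blast
    show "{0<..} \<subseteq> (\<Union>n. A n)"
    proof
      fix t :: real assume t: "t \<in> {0<..}"
      obtain n where n: "max t (1 / t) \<le> real n" using real_arch_simple by blast
      then have "1 \<le> t * real n" using t by (simp add: field_simps)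
      also have "\<dots> \<le> t * (real n + 1)" using t by simp
      finally have "1 / (real n + 1) \<le> t" by (simp add: field_simps)
      then show "t \<in> (\<Union>n. A n)" using n unfolding A_def by (intro UN_I[of n]) auto
    qed
  qed
  have cf: "continuous_on (half_plane 0) f"
    using hol by (rule holomorphic_on_imp_continuous_on)
  have cdf: "continuous_on (half_plane 0) (deriv f)"
    using hol by (intro holomorphic_on_imp_continuous_on holomorphic_deriv open_half_plane)
  have "G n holomorphic_on half_plane 0" for n
  proof -
    have cK: "continuous_on (A n) K"
      using Kcont Apos by (rule continuous_on_subset)
    have "(\<lambda>s. integral (cbox (1 / (real n + 1)) (real n + 1)) (g s)) holomorphic_on half_plane 0"
    proof (rule leibniz_rule_holomorphic[where
          fx = "\<lambda>s t. of_real (K t) * (deriv f (s + \<i> * of_real t) + deriv f (s - \<i> * of_real t))"])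
      fix s t assume s: "s \<in> half_plane 0"
      have Df: "(f has_field_derivative deriv f z) (at z)" if "z \<in> half_plane 0" for z
        using hol open_half_plane that by (rule holomorphic_derivI)
      have "((\<lambda>s. f (s + \<i> * of_real t)) has_field_derivative deriv f (s + \<i> * of_real t) * 1) (at s within half_plane 0)"
        by (rule DERIV_chain2[OF Df]) (use s in \<open>auto intro!: derivative_eq_intros simp: half_plane_def\<close>)
      moreover have "((\<lambda>s. f (s - \<i> * of_real t)) has_field_derivative deriv f (s - \<i> * of_real t) * 1) (at s within half_plane 0)"
        by (rule DERIV_chain2[OF Df]) (use s in \<open>auto intro!: derivative_eq_intros simp: half_plane_def\<close>)
      ultimately show "((\<lambda>s. g s t) has_field_derivative
          of_real (K t) * (deriv f (s + \<i> * of_real t) + deriv f (s - \<i> * of_real t))) (at s within half_plane 0)"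
        unfolding g_def by (intro DERIV_cmult DERIV_add) auto
    next
      fix s assume s: "s \<in> half_plane 0"
      have "continuous_on (A n) (g s)"
        unfolding g_def using s
        by (intro continuous_intros cK continuous_on_compose2[OF cf]) (auto simp: half_plane_def)
      then show "g s integrable_on cbox (1 / (real n + 1)) (real n + 1)"
        unfolding A_def by (intro integrable_continuous) simp
    next
      have "continuous_on (half_plane 0 \<times> A n)
          (\<lambda>p. of_real (K (snd p)) * (deriv f (fst p + \<i> * of_real (snd p)) + deriv f (fst p - \<i> * of_real (snd p))))"
        by (intro continuous_intros continuous_on_compose2[OF cK] continuous_on_compose2[OF cdf])
           (auto simp: half_plane_def)
      then show "continuous_on (half_plane 0 \<times> cbox (1 / (real n + 1)) (real n + 1))
          (\<lambda>(s, t). of_real (K t) * (deriv f (s + \<i> * of_real t) + deriv f (s - \<i> * of_real t)))"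
        by (simp add: A_def case_prod_beta)
    qed (rule convex_half_plane)
    then show ?thesis by (simp add: G_def A_def)
  qed
  note hol_G = this
  have aK: "set_integrable lborel {0<..} (\<lambda>t. \<bar>K t\<bar>)"
    using Kint by (rule set_integrable_abs)
  have "(\<lambda>n. LINT t:A n|lborel. \<bar>K t\<bar>) \<longlonglongrightarrow> (LINT t:(\<Union>n. A n)|lborel. \<bar>K t\<bar>)"
    by (rule set_integral_cont_up[OF Aset Aincr]) (simp add: AU aK)
  then have limA: "(\<lambda>n. LINT t:A n|lborel. \<bar>K t\<bar>) \<longlonglongrightarrow> (LINT t:{0<..}|lborel. \<bar>K t\<bar>)"
    unfolding AU .
  have lim: "(\<lambda>n. 2 * C * ((LINT t:{0<..}|lborel. \<bar>K t\<bar>) - (LINT t:A n|lborel. \<bar>K t\<bar>))) \<longlonglongrightarrow> 0"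
    using tendsto_mult[OF tendsto_const[of "2 * C"] tendsto_diff[OF tendsto_const[of "LINT t:{0<..}|lborel. \<bar>K t\<bar>"] limA]] by simp
  have split: "(LINT t:{0<..}|lborel. h t) - (LINT t:A n|lborel. h t) = (LINT t:{0<..} - A n|lborel. h t)"
    if h: "set_integrable lborel {0<..} h" for h :: "real \<Rightarrow> 'b::{banach, second_countable_topology}" and n
  proof -
    have "{0<..} = A n \<union> ({0<..} - A n)" using Apos by blast
    moreover have "(LINT t:A n \<union> ({0<..} - A n)|lborel. h t) = (LINT t:A n|lborel. h t) + (LINT t:{0<..} - A n|lborel. h t)"
    proof (rule set_integral_Un)
      show "set_integrable lborel (A n) h"
        by (rule set_integrable_subset[OF h Aset Apos])
      show "set_integrable lborel ({0<..} - A n) h"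
        by (rule set_integrable_subset[OF h]) (use Aset in auto)
    qed auto
    ultimately show ?thesis by simp
  qed
  have err: "dist (G n s) (vertical_average K f s)
      \<le> 2 * C * ((LINT t:{0<..}|lborel. \<bar>K t\<bar>) - (LINT t:A n|lborel. \<bar>K t\<bar>))"
    if s: "s \<in> half_plane 0" for n s
  proof -
    have int: "set_integrable lborel {0<..} (g s)"
      unfolding g_def by (rule vertical_integrable[OF s])
    have "G n s = (LINT t:A n|lborel. g s t)"
      unfolding G_def by (rule set_borel_integral_eq_integral(2)[symmetric])
        (rule set_integrable_subset[OF int Aset Apos])
    then have "dist (G n s) (vertical_average K f s) = norm (LINT t:{0<..} - A n|lborel. g s t)"
      unfolding split[OF int, of n, symmetric] vertical_average_def
      by (subst dist_commute) (simp add: dist_norm g_def)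
    also have "\<dots> \<le> 2 * C * (LINT t:{0<..} - A n|lborel. \<bar>K t\<bar>)"
      unfolding g_def
    proof (rule norm_set_integral_mult_le)
      show "set_integrable lborel ({0<..} - A n) K"
        by (rule set_integrable_subset[OF Kint]) (use Aset in auto)
      show "set_integrable lborel ({0<..} - A n) (\<lambda>t. of_real (K t) * (f (s + \<i> * of_real t) + f (s - \<i> * of_real t)))"
        by (rule set_integrable_subset[OF vertical_integrable[OF s]]) (use Aset in auto)
    qed (rule vertical_pair_bound[OF s])
    also have "(LINT t:{0<..} - A n|lborel. \<bar>K t\<bar>) = (LINT t:{0<..}|lborel. \<bar>K t\<bar>) - (LINT t:A n|lborel. \<bar>K t\<bar>)"
      by (rule split[OF aK, symmetric])
    finally show ?thesis .
  qed
  show ?thesis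
  proof (rule holomorphic_uniform_sequence[OF open_half_plane hol_G])
    fix s assume "s \<in> half_plane 0"
    then obtain d where d: "d > 0" "cball s d \<subseteq> half_plane 0"
      using open_half_plane open_contains_cball by blast
    have "uniform_limit (cball s d) G (vertical_average K f) sequentially"
    proof (rule uniform_limitI)
      fix e :: real assume "e > 0"
      then have "\<forall>\<^sub>F n in sequentially.
          2 * C * ((LINT t:{0<..}|lborel. \<bar>K t\<bar>) - (LINT t:A n|lborel. \<bar>K t\<bar>)) < e"
        using lim by (rule order_tendstoD(2)[rotated])
      then show "\<forall>\<^sub>F n in sequentially. \<forall>x\<in>cball s d. dist (G n x) (vertical_average K f x) < e"
        by eventually_elim (use err d in \<open>meson le_less_trans subsetD\<close>)
    qed
    with d show "\<exists>d>0. cball s d \<subseteq> half_plane 0 \<and> uniform_limit (cball s d) G (vertical_average K f) sequentially"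
      by blast
  qed
qed

end

section \<open>Partial sums as vertical averages, and the upper bound\<close>

lemma norm_of_nat_powr:
  assumes "n \<ge> 1"
  shows "norm (of_nat n powr z :: complex) = real n powr Re z"
  using assms by (subst norm_powr_real_powr) auto

text \<open>
  Conditional convergence at the single point \<open>\<sigma> + 1\<close> bounds the coefficients by a power of \<open>n\<close>, which gives
  absolute convergence two units further to the right.
\<close>

lemma dirichlet_rep_summable:
  assumes "dirichlet_rep a f"
  obtains \<sigma> where "\<sigma> > 0"
    and "\<And>s. s \<in> half_plane \<sigma> \<Longrightarrow> (\<lambda>n. a (Suc n) * of_nat (Suc n) powr (-s)) sums f s"
    and "\<And>s. s \<in> half_plane \<sigma> \<Longrightarrow> summable (\<lambda>n. norm (a (Suc n) * of_nat (Suc n) powr (-s)))"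
proof -
  obtain \<sigma> where \<sigma>: "\<sigma> > 0"
    and sums: "\<And>s. s \<in> half_plane \<sigma> \<Longrightarrow> (\<lambda>n. a (Suc n) * of_nat (Suc n) powr (-s)) sums f s"
    using assms unfolding dirichlet_rep_def by blast
  define s0 where "s0 = complex_of_real (\<sigma> + 1)"
  have "s0 \<in> half_plane \<sigma>" by (simp add: s0_def half_plane_def)
  then have "(\<lambda>n. a (Suc n) * of_nat (Suc n) powr (-s0)) \<longlonglongrightarrow> 0"
    using sums sums_summable summable_LIMSEQ_zero by blast
  then have "Bseq (\<lambda>n. a (Suc n) * of_nat (Suc n) powr (-s0))"
    by (intro convergent_imp_Bseq convergentI)
  then obtain C where C: "C > 0" "\<And>n. norm (a (Suc n) * of_nat (Suc n) powr (-s0)) \<le> C"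
    by (auto simp: Bseq_def)
  have "summable (\<lambda>n. norm (a (Suc n) * of_nat (Suc n) powr (-s)))" if s: "s \<in> half_plane (\<sigma> + 3)" for s
  proof (rule summable_comparison_test')
    have "summable (\<lambda>n. real n powr (-2))"
      by (simp add: summable_real_powr_iff)
    then have "summable (\<lambda>n. real (Suc n) powr (-2))"
      by (subst summable_Suc_iff)
    then show "summable (\<lambda>n. C * real (Suc n) powr (-2))"
      by (rule summable_mult)
    fix n
    have "norm (a (Suc n) * of_nat (Suc n) powr (-s))
        = norm (a (Suc n) * of_nat (Suc n) powr (-s0)) * real (Suc n) powr (\<sigma> + 1 - Re s)"
      by (simp add: norm_mult norm_of_nat_powr s0_def powr_add[symmetric] del: of_nat_Suc)
    also have "\<dots> \<le> C * real (Suc n) powr (-2)"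
      using s C by (intro mult_mono powr_mono) (auto simp: half_plane_def)
    finally show "norm (norm (a (Suc n) * of_nat (Suc n) powr (-s))) \<le> C * real (Suc n) powr (-2)"
      by simp
  qed
  with \<sigma> sums show ?thesis
    by (intro that[of "\<sigma> + 3"]) (auto simp: half_plane_def)
qed

lemma powr_vertical_pair:
  assumes "n \<ge> 1"
  shows "of_nat n powr (- (s + \<i> * of_real t)) + of_nat n powr (- (s - \<i> * of_real t))
         = of_nat n powr (-s) * of_real (2 * cos (ln (real n) * t))"
proof -
  have e: "of_nat n powr z = exp (z * of_real (ln (real n)))" for z :: complex
    using assms by (simp add: powr_def)
  have "of_nat n powr (- (s + \<i> * of_real t)) = of_nat n powr (-s) * cis (- (ln (real n) * t))"
    unfolding e cis_conv_exp exp_add[symmetric] by (simp add: algebra_simps)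
  moreover have "of_nat n powr (- (s - \<i> * of_real t)) = of_nat n powr (-s) * cis (ln (real n) * t)"
    unfolding e cis_conv_exp exp_add[symmetric] by (simp add: algebra_simps)
  moreover have "cis (- (ln (real n) * t)) + cis (ln (real n) * t) = of_real (2 * cos (ln (real n) * t))"
    by (simp add: complex_eq_iff)
  ultimately show ?thesis
    by (metis distrib_left)
qed

text \<open>
  No frequency \<open>ln n\<close> lies strictly between \<open>ln N\<close> and \<open>ln (N + 1)\<close>, so the trapezoid with these two
  break points acts on Dirichlet series as the sharp cutoff at \<open>N\<close>.
\<close>

abbreviation sharp_kernel :: "nat \<Rightarrow> real \<Rightarrow> real" where
  "sharp_kernel N \<equiv> vp_kernel (ln (real N)) (ln (real (Suc N)))"

text \<open>
  Where the Dirichlet series converges absolutely, sum and integral may be interchanged, and the kernel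
  multiplies the \<open>n\<close>-th term by \<open>1\<close> if \<open>n \<le> N\<close> and by \<open>0\<close> otherwise.
\<close>

lemma vertical_average_dirichlet_abs:
  assumes N: "N \<ge> 1"
    and sums: "\<And>t. (\<lambda>n. a (Suc n) * of_nat (Suc n) powr (-(s + \<i> * of_real t))) sums f (s + \<i> * of_real t)"
    and sums': "\<And>t. (\<lambda>n. a (Suc n) * of_nat (Suc n) powr (-(s - \<i> * of_real t))) sums f (s - \<i> * of_real t)"
    and summable: "summable (\<lambda>n. norm (a (Suc n) * of_nat (Suc n) powr (-s)))"
  shows "vertical_average (sharp_kernel N) f s = (\<Sum>n=1..N. a n * of_nat n powr (-s))"
proof -
  define K where "K = sharp_kernel N"
  define b where "b = (\<lambda>n. a (Suc n) * of_nat (Suc n) powr (-s))"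
  define w where "w = (\<lambda>n t. 2 * cos (ln (real (Suc n)) * t) * K t)"
  define u where "u = (\<lambda>n t. b n * of_real (indicator {0<..} t *\<^sub>R w n t))"
  have lnN: "0 \<le> ln (real N)" "ln (real N) < ln (real (Suc N))"
    using N by auto
  have w: "set_integrable lborel {0<..} (w n)"
      "(LINT t:{0<..}|lborel. w n t) = (if n < N then 1 else 0)" for n
  proof -
    have "0 \<le> ln (real (Suc n))" by simp
    moreover have "ln (real (Suc n)) \<le> ln (real N) \<or> ln (real (Suc N)) \<le> ln (real (Suc n))"
      using N by (cases "n < N") auto
    moreover have "ln (real (Suc n)) \<le> ln (real N) \<longleftrightarrow> n < N"
      using N by auto
    ultimately show "set_integrable lborel {0<..} (w n)"
      "(LINT t:{0<..}|lborel. w n t) = (if n < N then 1 else 0)"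
      unfolding w_def K_def using vp_kernel_cos_integral[OF lnN, of "ln (real (Suc n))"] by auto
  qed
  have u_int: "integrable lborel (u n)" for n
    using w(1)[of n] unfolding u_def set_integrable_def
    by (intro integrable_mult_right integrable_of_real)
  have u_val: "integral\<^sup>L lborel (u n) = (if n < N then b n else 0)" for n
  proof -
    have "integral\<^sup>L lborel (u n) = b n * of_real (LINT t|lborel. indicator {0<..} t *\<^sub>R w n t)"
      using w(1)[of n] unfolding u_def set_integrable_def
      by (simp only: integral_mult_right_zero integral_of_real)
    also have "(LINT t|lborel. indicator {0<..} t *\<^sub>R w n t) = (if n < N then 1 else 0)"
      using w(2)[of n] unfolding set_lebesgue_integral_def .
    finally show ?thesis by simp
  qed
  have u_norm: "norm (u n t) \<le> norm (b n) * (2 * (indicator {0<..} t *\<^sub>R \<bar>K t\<bar>))" for n t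
  proof -
    have "\<bar>w n t\<bar> \<le> 2 * 1 * \<bar>K t\<bar>"
      unfolding w_def abs_mult by (intro mult_mono) auto
    then show ?thesis unfolding u_def norm_mult
      by (intro mult_left_mono) (auto simp: indicator_def)
  qed
  have aK: "integrable lborel (\<lambda>t. indicator {0<..} t *\<^sub>R \<bar>K t\<bar>)"
    using set_integrable_abs[OF vp_kernel_integrable] unfolding K_def set_integrable_def .
  have sb: "summable (\<lambda>n. norm (b n))" using summable unfolding b_def .
  have "(\<lambda>n. integral\<^sup>L lborel (u n)) sums (LINT t|lborel. (\<Sum>n. u n t))"
  proof (rule sums_integral[OF u_int])
    show "AE t in lborel. summable (\<lambda>n. norm (u n t))"
      by (intro AE_I2 summable_comparison_test'[OF summable_mult2[OF sb]]) (use u_norm in auto)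
    show "summable (\<lambda>n. LINT t|lborel. norm (u n t))"
    proof (rule summable_comparison_test'[OF summable_mult2[OF sb]])
      fix n
      have "(LINT t|lborel. norm (u n t)) \<le> (LINT t|lborel. norm (b n) * (2 * (indicator {0<..} t *\<^sub>R \<bar>K t\<bar>)))"
        using u_int aK u_norm by (intro integral_mono integrable_norm integrable_mult_right) auto
      then show "norm (LINT t|lborel. norm (u n t)) \<le> norm (b n) * (2 * (LINT t|lborel. indicator {0<..} t *\<^sub>R \<bar>K t\<bar>))"
        by simp
    qed
  qed
  moreover have "(\<Sum>n. u n t) = indicator {0<..} t *\<^sub>R (of_real (K t) * (f (s + \<i> * of_real t) + f (s - \<i> * of_real t)))" for t
  proof -
    have "u n t = of_real (indicator {0<..} t * K t) *
       (a (Suc n) * of_nat (Suc n) powr (-(s + \<i> * of_real t)) + a (Suc n) * of_nat (Suc n) powr (-(s - \<i> * of_real t)))" for n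
      unfolding distrib_left[symmetric] powr_vertical_pair[of "Suc n", simplified]
      by (subst powr_vertical_pair) (simp_all add: u_def w_def b_def mult_ac del: of_nat_Suc)
    then have "(\<lambda>n. u n t) sums (of_real (indicator {0<..} t * K t) * (f (s + \<i> * of_real t) + f (s - \<i> * of_real t)))"
      by (simp only:) (intro sums_mult sums_add sums sums')
    then show ?thesis
      by (simp add: sums_iff scaleR_conv_of_real mult_ac)
  qed
  ultimately have "(\<lambda>n. if n < N then b n else 0) sums vertical_average K f s"
    by (simp add: u_val vertical_average_def set_lebesgue_integral_def)
  moreover have "(\<lambda>n. if n < N then b n else 0) sums (\<Sum>n | n < N. b n)"
    using sums_If_finite[of "\<lambda>n. n < N" b] by simp
  ultimately have "vertical_average K f s = (\<Sum>n<N. b n)"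
    using sums_unique2 by (force simp: lessThan_def)
  also have "\<dots> = (\<Sum>n=1..N. a n * of_nat n powr (-s))"
    unfolding b_def by (rule sum.reindex_bij_witness[of _ "\<lambda>n. n - 1" Suc]) auto
  finally show ?thesis unfolding K_def .
qed

text \<open>
  Both sides are holomorphic on the right half-plane and agree far to the right, where the series converges
  absolutely.
\<close>

lemma partial_sum_eq_vertical_average:
  assumes hol: "f holomorphic_on half_plane 0" and bdd: "bounded (f ` half_plane 0)"
    and rep: "dirichlet_rep a f" and N: "N \<ge> 1" and s: "s \<in> half_plane 0"
  shows "(\<Sum>n=1..N. a n * of_nat n powr (-s)) = vertical_average (sharp_kernel N) f s"
proof -
  obtain C where C: "\<And>s. s \<in> half_plane 0 \<Longrightarrow> norm (f s) \<le> C"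
    using bdd by (auto simp: bounded_iff)
  obtain \<sigma> where \<sigma>: "\<sigma> > 0"
    and sums: "\<And>s. s \<in> half_plane \<sigma> \<Longrightarrow> (\<lambda>n. a (Suc n) * of_nat (Suc n) powr (-s)) sums f s"
    and summ: "\<And>s. s \<in> half_plane \<sigma> \<Longrightarrow> summable (\<lambda>n. norm (a (Suc n) * of_nat (Suc n) powr (-s)))"
    using dirichlet_rep_summable[OF rep] by blast
  have "continuous_on {0<..} (sharp_kernel N)"
    unfolding vp_kernel_def using N by (intro continuous_intros) auto
  then have hol': "vertical_average (sharp_kernel N) f holomorphic_on half_plane 0"
    using vp_kernel_integrable hol C by (rule vertical_average_holomorphic)
  show ?thesis
  proof (rule analytic_continuation_open[OF open_half_plane open_half_plane _ _ _ _ hol' _ s])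
    show "half_plane \<sigma> \<noteq> {}"
    proof -
      have "of_real (\<sigma> + 1) \<in> half_plane \<sigma>" by (simp add: half_plane_def)
      then show ?thesis by blast
    qed
    show "connected (half_plane 0)" by (rule convex_connected[OF convex_half_plane])
    show "half_plane \<sigma> \<subseteq> half_plane 0" using \<sigma> by (auto simp: half_plane_def)
    show "(\<lambda>s. \<Sum>n=1..N. a n * of_nat n powr (-s)) holomorphic_on half_plane 0"
      by (intro holomorphic_intros) auto
    fix s assume s: "s \<in> half_plane \<sigma>"
    have "s + \<i> * of_real t \<in> half_plane \<sigma>" "s - \<i> * of_real t \<in> half_plane \<sigma>" for t
      using s by (auto simp: half_plane_def)
    then show "(\<Sum>n=1..N. a n * of_nat n powr (-s)) = vertical_average (sharp_kernel N) f s"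
      by (intro vertical_average_dirichlet_abs[OF N, symmetric] sums summ s)
  qed
qed

lemma Hinf_dirichlet_coeff:
  assumes "f \<in> Hinf"
  shows "dirichlet_rep (dirichlet_coeff f) f"
  using assms someI_ex[of "\<lambda>a. dirichlet_rep a f"] unfolding Hinf_def dirichlet_coeff_def by blast

text \<open>
  The vertical average depends on \<open>f\<close> alone. Hence all coefficient sequences representing \<open>f\<close> have the
  same partial sums, and the one chosen in the definition of the operator may be replaced by any other.
\<close>

lemma partial_sum_op_eq:
  assumes "f \<in> Hinf" "dirichlet_rep a f" "N \<ge> 1" "s \<in> half_plane 0"
  shows "partial_sum_op N f s = (\<Sum>n=1..N. a n * of_nat n powr (-s))"
  using partial_sum_eq_vertical_average[OF _ _ Hinf_dirichlet_coeff[OF assms(1)] assms(3,4)]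
        partial_sum_eq_vertical_average[OF _ _ assms(2) assms(3,4)] assms(1)
  by (simp add: Hinf_def partial_sum_op_def)

lemma Hinf_norm_leD:
  assumes "Hinf_norm f \<le> ereal c" "s \<in> half_plane 0"
  shows "norm (f s) \<le> c"
  using assms unfolding Hinf_norm_def by (simp add: SUP_le_iff)

lemma Hinf_opnorm_partial_sum_le:
  assumes N: "N \<ge> 1"
  shows "Hinf_opnorm (partial_sum_op N) \<le> ereal (2 * (LINT t:{0<..}|lborel. \<bar>sharp_kernel N t\<bar>))"
  unfolding Hinf_opnorm_def
proof (rule SUP_least)
  fix f assume "f \<in> {f \<in> Hinf. Hinf_norm f \<le> 1}"
  then have f: "f \<in> Hinf" and bd: "\<And>s. s \<in> half_plane 0 \<Longrightarrow> norm (f s) \<le> 1"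
    using Hinf_norm_leD[of f 1] by (auto simp: one_ereal_def)
  have hol: "f holomorphic_on half_plane 0" "bounded (f ` half_plane 0)"
    using f by (auto simp: Hinf_def)
  have cont: "continuous_on {0<..} (sharp_kernel N)"
    unfolding vp_kernel_def using N by (intro continuous_intros) auto
  show "Hinf_norm (partial_sum_op N f) \<le> ereal (2 * (LINT t:{0<..}|lborel. \<bar>sharp_kernel N t\<bar>))"
    unfolding Hinf_norm_def
  proof (rule SUP_least)
    fix s assume s: "s \<in> half_plane 0"
    have "partial_sum_op N f s = vertical_average (sharp_kernel N) f s"
      unfolding partial_sum_op_def
      by (rule partial_sum_eq_vertical_average[OF hol Hinf_dirichlet_coeff[OF f] N s])
    then show "ereal (norm (partial_sum_op N f s)) \<le> ereal (2 * (LINT t:{0<..}|lborel. \<bar>sharp_kernel N t\<bar>))"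
      using norm_vertical_average_le[OF cont vp_kernel_integrable hol(1) bd s] by simp
  qed
qed

lemma Hinf_opnorm_upper:
  "\<forall>\<^sub>F N in sequentially. Hinf_opnorm (partial_sum_op N) \<le> ereal (7 * ln (real N))"
proof -
  have "\<forall>\<^sub>F N in sequentially.
      2 * ((ln (real N) + ln (real N + 1)) / 2 + 2 * ln (1 + 2 / (ln (real N + 1) - ln (real N)))) \<le> 7 * ln (real N)"
    by real_asymp
  then show ?thesis
    using eventually_ge_at_top[of 1]
  proof eventually_elim
    case (elim N)
    define B where "B = (ln (real N) + ln (real (Suc N))) / 2 + 2 * ln (1 + 2 / (ln (real (Suc N)) - ln (real N)))"
    have "B \<ge> 0" unfolding B_def using elim by simp
    have "(LINT t:{0<..}|lborel. \<bar>sharp_kernel N t\<bar>) \<le> B / pi"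
      unfolding B_def using elim by (intro vp_kernel_L1_bound) auto
    also have "\<dots> \<le> B / 1"
      using \<open>B \<ge> 0\<close> pi_ge_two by (intro divide_left_mono) auto
    moreover have "2 * B \<le> 7 * ln (real N)"
      using elim(1) by (simp add: B_def add.commute)
    ultimately have "2 * (LINT t:{0<..}|lborel. \<bar>sharp_kernel N t\<bar>) \<le> 7 * ln (real N)"
      by linarith
    then show ?case
      using Hinf_opnorm_partial_sum_le[OF elim(2)] order_trans ereal_less_eq(3) by blast
  qed
qed

section \<open>Hilbert's inequality and triangular truncation\<close>

lemma sawtooth_fourier:
  fixes n :: int
  shows "((\<lambda>t. of_real (t - pi) * cis (of_int n * t)) has_integral
           (if n = 0 then 0 else - (2 * pi * \<i>) / of_int n)) {0..2 * pi}"
proof (cases "n = 0")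
  case True
  have "((\<lambda>t. t - pi) has_integral ((2 * pi - pi)\<^sup>2 / 2 - (0 - pi)\<^sup>2 / 2)) {0..2 * pi}"
    by (rule fundamental_theorem_of_calculus)
       (auto intro!: derivative_eq_intros
          simp: has_real_derivative_iff_has_vector_derivative[symmetric])
  from has_integral_linear[OF this bounded_linear_of_real[where 'a = complex]]
  show ?thesis using True by (simp add: comp_def)
next
  case False
  define F where "F = (\<lambda>t. of_real (t - pi) * cis (of_int n * t) / (\<i> * of_int n) + cis (of_int n * t) / (of_int n)\<^sup>2)"
  have D: "(F has_vector_derivative of_real (t - pi) * cis (of_int n * t)) (at t within {0..2*pi})" for t
    unfolding F_def cis_conv_exp using False
    by (auto intro!: derivative_eq_intros has_vector_derivative_real_field
          simp: field_simps power2_eq_square)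
  have "((\<lambda>t. of_real (t - pi) * cis (of_int n * t)) has_integral (F (2 * pi) - F 0)) {0..2 * pi}"
    by (rule fundamental_theorem_of_calculus) (use D in auto)
  also have "cis (of_int n * (2 * pi)) = 1"
    using cis_multiple_2pi[of "of_int n"] by (simp add: mult_ac)
  then have "F (2 * pi) - F 0 = - (2 * pi * \<i>) / of_int n"
    using False unfolding F_def by (simp add: field_simps)
  finally show ?thesis using False by simp
qed

lemma trig_monomial_integral:
  fixes n :: int
  shows "((\<lambda>t. cis (of_int n * t)) has_integral (if n = 0 then 2 * pi else 0)) {0..2 * pi}"
proof (cases "n = 0")
  case True
  have "((\<lambda>t. 1 :: complex) has_integral (2 * pi - 0) *\<^sub>R 1) {0..2 * pi}"
    using has_integral_const_real[of "1::complex" 0 "2 * pi"] by simp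
  then show ?thesis using True by (simp add: scaleR_conv_of_real)
next
  case False
  define F where "F = (\<lambda>t. cis (of_int n * t) / (\<i> * of_int n))"
  have D: "(F has_vector_derivative cis (of_int n * t)) (at t within {0..2*pi})" for t
    unfolding F_def cis_conv_exp using False
    by (auto intro!: derivative_eq_intros has_vector_derivative_real_field simp: field_simps)
  have "((\<lambda>t. cis (of_int n * t)) has_integral (F (2 * pi) - F 0)) {0..2 * pi}"
    by (rule fundamental_theorem_of_calculus) (use D in auto)
  also have "cis (of_int n * (2 * pi)) = 1"
    using cis_multiple_2pi[of "of_int n"] by (simp add: mult_ac)
  then have "F (2 * pi) - F 0 = 0"
    unfolding F_def by simp
  finally show ?thesis using False by simp
qed

lemma parseval_trig_poly:
  fixes x :: "nat \<Rightarrow> complex"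
  assumes "finite I"
  shows "((\<lambda>t. (norm (\<Sum>i\<in>I. x i * cis (of_int (int i) * t)))\<^sup>2) has_integral
            2 * pi * (\<Sum>i\<in>I. (norm (x i))\<^sup>2)) {0..2 * pi}"
proof -
  have "((\<lambda>t. \<Sum>i\<in>I. \<Sum>j\<in>I. x i * cnj (x j) * cis (of_int (int i - int j) * t)) has_integral
      (\<Sum>i\<in>I. \<Sum>j\<in>I. x i * cnj (x j) * (if int i - int j = 0 then 2 * pi else 0))) {0..2 * pi}"
    by (intro has_integral_sum has_integral_mult_right trig_monomial_integral assms)
  moreover have "(\<Sum>i\<in>I. \<Sum>j\<in>I. x i * cnj (x j) * cis (of_int (int i - int j) * t))
      = of_real ((norm (\<Sum>i\<in>I. x i * cis (of_int (int i) * t)))\<^sup>2)" for t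
    unfolding complex_norm_square cnj_sum sum_product
    by (intro sum.cong refl) (simp add: cis_cnj cis_mult left_diff_distrib right_diff_distrib mult_ac)
  moreover have "(\<Sum>i\<in>I. \<Sum>j\<in>I. x i * cnj (x j) * (if int i - int j = 0 then 2 * pi else 0))
      = of_real (2 * pi * (\<Sum>i\<in>I. (norm (x i))\<^sup>2))"
    using assms unfolding of_real_mult of_real_sum complex_norm_square sum_distrib_left
    by (intro sum.cong refl) (simp add: if_distrib mult_ac cong: if_cong)
  ultimately have "((\<lambda>t. complex_of_real ((norm (\<Sum>i\<in>I. x i * cis (of_int (int i) * t)))\<^sup>2)) has_integral
      of_real (2 * pi * (\<Sum>i\<in>I. (norm (x i))\<^sup>2))) {0..2 * pi}"
    by (simp only:)
  from has_integral_linear[OF this bounded_linear_Re] show ?thesis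
    by (simp only: comp_def Re_complex_of_real)
qed

text \<open>
  Hilbert's inequality with the sharp constant \<open>\<pi>\<close>, in the form left after the arithmetic-geometric mean
  inequality. The diagonal terms vanish because division by \<open>0\<close> gives \<open>0\<close>. The matrix entry
  \<open>1/(j - i)\<close> is, up to the factor \<open>\<i>/(2\<pi>)\<close>, a Fourier coefficient of the sawtooth \<open>t - \<pi>\<close>, which is at most
  \<open>\<pi>\<close> in absolute value; so the double sum is an integral of the sawtooth against a product of two
  trigonometric polynomials, to which Parseval's identity applies.
\<close>

lemma hilbert_inequality:
  fixes x y :: "nat \<Rightarrow> complex"
  assumes "finite I"
  shows "norm (\<Sum>i\<in>I. \<Sum>j\<in>I. x i * y j / of_int (int j - int i))
          \<le> pi / 2 * ((\<Sum>i\<in>I. (norm (x i))\<^sup>2) + (\<Sum>j\<in>I. (norm (y j))\<^sup>2))"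
proof -
  \<comment> \<open>the conjugates make the product \<open>cnj (X t) * Y t\<close> have the frequencies \<open>j - i\<close>\<close>
  define X where "X = (\<lambda>t. \<Sum>i\<in>I. cnj (x i) * cis (of_int (int i) * t))"
  define Y where "Y = (\<lambda>t. \<Sum>j\<in>I. y j * cis (of_int (int j) * t))"
  define S where "S = (\<Sum>i\<in>I. \<Sum>j\<in>I. x i * y j / of_int (int j - int i))"
  define Q where "Q = (\<Sum>i\<in>I. (norm (x i))\<^sup>2) + (\<Sum>j\<in>I. (norm (y j))\<^sup>2)"
  have "((\<lambda>t. \<Sum>i\<in>I. \<Sum>j\<in>I. x i * y j * (of_real (t - pi) * cis (of_int (int j - int i) * t))) has_integral
      (\<Sum>i\<in>I. \<Sum>j\<in>I. x i * y j * (if int j - int i = 0 then 0 else - (2 * pi * \<i>) / of_int (int j - int i)))) {0..2 * pi}"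
    by (intro has_integral_sum has_integral_mult_right sawtooth_fourier assms)
  moreover have "(\<Sum>i\<in>I. \<Sum>j\<in>I. x i * y j * (of_real (t - pi) * cis (of_int (int j - int i) * t)))
      = of_real (t - pi) * (cnj (X t) * Y t)" for t
    unfolding X_def Y_def cnj_sum sum_product
    unfolding sum_distrib_left
    by (intro sum.cong refl) (simp add: cis_cnj cis_mult left_diff_distrib right_diff_distrib mult_ac)
  moreover have "(\<Sum>i\<in>I. \<Sum>j\<in>I. x i * y j * (if int j - int i = 0 then 0 else - (2 * pi * \<i>) / of_int (int j - int i)))
      = - (2 * pi * \<i>) * S"
    unfolding S_def sum_distrib_left by (intro sum.cong refl) auto
  ultimately have 1: "((\<lambda>t. of_real (t - pi) * (cnj (X t) * Y t)) has_integral - (2 * pi * \<i>) * S) {0..2 * pi}"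
    by simp
  have 2: "((\<lambda>t. pi / 2 * ((norm (X t))\<^sup>2 + (norm (Y t))\<^sup>2)) has_integral
      pi / 2 * (2 * pi * (\<Sum>i\<in>I. (norm (cnj (x i)))\<^sup>2) + 2 * pi * (\<Sum>j\<in>I. (norm (y j))\<^sup>2))) {0..2 * pi}"
    unfolding X_def Y_def by (intro has_integral_mult_right has_integral_add parseval_trig_poly assms)
  have "norm (integral {0..2 * pi} (\<lambda>t. of_real (t - pi) * (cnj (X t) * Y t)))
      \<le> integral {0..2 * pi} (\<lambda>t. pi / 2 * ((norm (X t))\<^sup>2 + (norm (Y t))\<^sup>2))"
  proof (rule integral_norm_bound_integral)
    fix t assume t: "t \<in> {0..2 * pi}"
    have "2 * (norm (X t) * norm (Y t)) \<le> (norm (X t))\<^sup>2 + (norm (Y t))\<^sup>2"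
      using sum_squares_bound[of "norm (X t)" "norm (Y t)"] by (simp add: mult_ac)
    moreover have "\<bar>t - pi\<bar> \<le> pi" using t by auto
    ultimately have "\<bar>t - pi\<bar> * (norm (X t) * norm (Y t)) \<le> pi * (((norm (X t))\<^sup>2 + (norm (Y t))\<^sup>2) / 2)"
      by (intro mult_mono) auto
    then show "norm (of_real (t - pi) * (cnj (X t) * Y t)) \<le> pi / 2 * ((norm (X t))\<^sup>2 + (norm (Y t))\<^sup>2)"
      by (simp add: norm_mult norm_of_real del: of_real_diff)
  qed (use 1 2 in \<open>auto simp: integrable_on_def\<close>)
  then have "norm (- (2 * pi * \<i>) * S) \<le> pi / 2 * (2 * pi * Q)"
    using 1 2 by (simp add: integral_unique Q_def distrib_left)
  then have "2 * pi * norm S \<le> 2 * pi * (pi / 2 * Q)"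
    by (simp add: norm_mult norm_divide mult_ac)
  then show ?thesis unfolding S_def Q_def
    by (subst (asm) mult_le_cancel_left_pos) auto
qed

text \<open>
  Passing from \<open>M\<close> to \<open>M + 1\<close> adds a column with sum \<open>1 + 1/2 + \<dots> + 1/M \<ge> ln (M + 1)\<close>.
\<close>

lemma truncated_hilbert_sum:
  assumes "M \<ge> 1"
  shows "real M * (ln (real M) - 1) \<le> (\<Sum>i=1..M. \<Sum>j=1..M. if i < j then 1 / (real j - real i) else 0)"
  using assms
proof (induction M rule: dec_induct)
  case (step M)
  have M: "real M > 0" using step by simp
  define T where "T = (\<lambda>M. \<Sum>i=1..M. \<Sum>j=1..M. if i < j then 1 / (real j - real i) else (0::real))"
  have "ln (real (Suc M)) \<le> harm M"
    using ln_le_harm[of M] by (simp add: add.commute)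
  also have "harm M = (\<Sum>k=1..M. 1 / real k)"
    by (simp add: harm_def inverse_eq_divide)
  also have "\<dots> = (\<Sum>i=1..M. 1 / (real (Suc M) - real i))"
    by (rule sum.reindex_bij_witness[of _ "\<lambda>i. Suc M - i" "\<lambda>i. Suc M - i"]) (auto simp: of_nat_diff)
  finally have h: "ln (real (Suc M)) \<le> (\<Sum>i=1..M. 1 / (real (Suc M) - real i))" .
  have "T (Suc M) = (\<Sum>i=1..M. (\<Sum>j=1..M. if i < j then 1 / (real j - real i) else 0) + 1 / (real (Suc M) - real i))"
    unfolding T_def by (simp add: sum.cl_ivl_Suc cong: if_cong)
  also have "\<dots> = T M + (\<Sum>i=1..M. 1 / (real (Suc M) - real i))"
    unfolding T_def by (simp add: sum.distrib)
  finally have "T (Suc M) \<ge> real M * (ln (real M) - 1) + ln (real (Suc M))"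
    using h step.IH unfolding T_def by linarith
  moreover have "real M * (ln (real (Suc M)) - ln (real M)) \<le> 1"
  proof -
    have "ln (real (Suc M)) - ln (real M) = ln (1 + 1 / real M)"
    proof -
      have "1 + 1 / real M = real (Suc M) / real M" using M by (simp add: field_simps)
      then show ?thesis using M by (simp add: ln_div)
    qed
    also have "\<dots> \<le> 1 / real M"
      using M by (intro ln_add_one_self_le_self) auto
    finally show ?thesis using M by (simp add: field_simps)
  qed
  moreover have "real (Suc M) * (ln (real (Suc M)) - 1) =
      real M * (ln (real M) - 1) + ln (real (Suc M)) + (real M * (ln (real (Suc M)) - ln (real M)) - 1)"
    by (simp add: algebra_simps)
  ultimately show ?case unfolding T_def by linarith
qed simp

text \<open>
  This turns a cutoff of products at \<open>N\<close> into triangular truncation of a matrix. It holds because the numbers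
  \<open>N/j\<close> with \<open>j \<le> \<surd>N\<close> are at least \<open>1\<close> apart, so that their integer parts are still strictly decreasing.
\<close>

lemma hyperbola_truncation_iff:
  fixes i j M N :: nat
  assumes "1 \<le> i" "i \<le> M" "1 \<le> j" "j \<le> M" "M * M \<le> N"
  shows "i * (N div j) \<le> N \<longleftrightarrow> i \<le> j"
proof
  assume "i \<le> j"
  then have "i * (N div j) \<le> j * (N div j)" by simp
  also have "\<dots> \<le> N" by simp
  finally show "i * (N div j) \<le> N" .
next
  assume *: "i * (N div j) \<le> N"
  show "i \<le> j"
  proof (rule ccontr)
    assume "\<not> i \<le> j"
    then have ij: "Suc j \<le> i" by simp
    have mod: "N mod j \<le> j - 1"
      using mod_less_divisor[of j N] assms by linarith
    have "i * N = i * (N div j) * j + i * (N mod j)"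
      by (metis add_mult_distrib2 div_mult_mod_eq mult.assoc)
    also have "\<dots> \<le> N * j + i * (j - 1)"
      using * mod by (intro add_mono mult_right_mono mult_left_mono) auto
    finally have 1: "i * N \<le> N * j + i * (j - 1)" .
    have "Suc j * N \<le> i * N" using ij by (intro mult_right_mono) auto
    with 1 have "N \<le> i * (j - 1)" by (simp add: mult_ac)
    moreover have "i * (j - 1) < M * M"
      using assms by (intro mult_le_less_imp_less) auto
    ultimately show False using assms by simp
  qed
qed

section \<open>The Hilbert polynomial and the lower bound\<close>

text \<open>
  The bilinear form of the Hilbert matrix evaluated at \<open>x\<^sub>i = i\<^bsup>-s\<^esup>\<close> and \<open>y\<^sub>j = \<lfloor>N/j\<rfloor>\<^bsup>-s\<^esup>\<close>. The diagonal is
  absent, its entries being \<open>1/0 = 0\<close>.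
\<close>

definition hilbert_poly :: "nat \<Rightarrow> nat \<Rightarrow> complex \<Rightarrow> complex" where
  "hilbert_poly M N s =
     (\<Sum>i=1..M. \<Sum>j=1..M. of_nat i powr (-s) * of_nat (N div j) powr (-s) / of_int (int j - int i))"

definition hilbert_coeff :: "nat \<Rightarrow> nat \<Rightarrow> nat \<Rightarrow> complex" where
  "hilbert_coeff M N n =
     (\<Sum>(i, j) \<in> {(i, j). i \<in> {1..M} \<and> j \<in> {1..M} \<and> i * (N div j) = n}. 1 / of_int (int j - int i))"

lemma of_nat_mult_powr: "of_nat (m * n) powr s = of_nat m powr s * (of_nat n powr s :: complex)"
proof (cases "m = 0 \<or> n = 0")
  case False
  then have "of_nat (m * n) powr s = exp (s * of_real (ln (real (m * n))))"
    by (simp add: powr_def del: of_nat_mult)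
  also have "ln (real (m * n)) = ln (real m) + ln (real n)"
    using False by (simp add: ln_mult)
  finally show ?thesis
    using False by (simp add: powr_def exp_add distrib_left)
qed auto

text \<open>
  The cutoff at \<open>L\<close> acts on products, whichever pair \<open>(i, j)\<close> a given frequency comes from. The hypothesis
  keeps all \<open>N div j\<close> positive, so that no frequency \<open>0\<close> occurs.
\<close>

lemma hilbert_coeff_sum:
  assumes "M * M \<le> N"
  shows "(\<Sum>n=1..L. hilbert_coeff M N n * of_nat n powr (-s)) =
    (\<Sum>i=1..M. \<Sum>j=1..M. if i * (N div j) \<le> L
        then of_nat i powr (-s) * of_nat (N div j) powr (-s) / of_int (int j - int i) else 0)"
proof -
  define P where "P = {1..M} \<times> {1..M}"
  define \<nu> where "\<nu> = (\<lambda>(i, j). i * (N div j))"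
  define h where "h = (\<lambda>(i, j). of_nat i powr (-s) * of_nat (N div j) powr (-s) / (of_int (int j - int i) :: complex))"
  have pos: "\<nu> p \<ge> 1" if pP: "p \<in> P" for p
  proof -
    obtain i j where p: "p = (i, j)" "1 \<le> i" "1 \<le> j" "j \<le> M"
      using pP unfolding P_def by auto
    have "j \<le> M * M" using p by (metis le_square le_trans)
    then have "N div j \<ge> 1" using p assms by (simp add: div_greater_zero_iff Suc_le_eq)
    then show ?thesis using p by (simp add: \<nu>_def)
  qed
  have "hilbert_coeff M N n * of_nat n powr (-s) = (\<Sum>p | p \<in> P \<and> \<nu> p = n. h p)" for n
  proof -
    have "{(i, j). i \<in> {1..M} \<and> j \<in> {1..M} \<and> i * (N div j) = n} = {p. p \<in> P \<and> \<nu> p = n}"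
      by (auto simp: P_def \<nu>_def)
    then have "hilbert_coeff M N n * of_nat n powr (-s)
        = (\<Sum>p | p \<in> P \<and> \<nu> p = n. (case p of (i, j) \<Rightarrow> 1 / of_int (int j - int i)) * of_nat n powr (-s))"
      unfolding hilbert_coeff_def by (simp add: sum_distrib_right)
    also have "\<dots> = (\<Sum>p | p \<in> P \<and> \<nu> p = n. h p)"
      by (intro sum.cong refl) (auto simp: h_def \<nu>_def of_nat_mult_powr[symmetric] simp del: of_nat_mult)
    finally show ?thesis .
  qed
  then have "(\<Sum>n=1..L. hilbert_coeff M N n * of_nat n powr (-s)) = (\<Sum>n=1..L. \<Sum>p | p \<in> P \<and> \<nu> p = n. h p)"
    by simp
  also have "\<dots> = (\<Sum>n=1..L. \<Sum>p | p \<in> {p \<in> P. \<nu> p \<le> L} \<and> \<nu> p = n. h p)"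
    by (intro sum.cong refl) auto
  also have "\<dots> = (\<Sum>p \<in> {p \<in> P. \<nu> p \<le> L}. h p)"
    using pos by (intro sum.group) (auto simp: P_def)
  also have "\<dots> = (\<Sum>p\<in>P. if \<nu> p \<le> L then h p else 0)"
    by (simp add: P_def sum.inter_filter)
  also have "\<dots> = (\<Sum>i=1..M. \<Sum>j=1..M. if i * (N div j) \<le> L
        then of_nat i powr (-s) * of_nat (N div j) powr (-s) / of_int (int j - int i) else 0)"
    unfolding P_def by (subst sum.cartesian_product) (auto intro!: sum.cong simp: \<nu>_def h_def)
  finally show ?thesis .
qed

lemma hilbert_poly_dirichlet_rep:
  assumes "M * M \<le> N"
  shows "dirichlet_rep (hilbert_coeff M N) (hilbert_poly M N)"
  unfolding dirichlet_rep_def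
proof (intro exI[of _ 1] conjI ballI)
  fix s
  \<comment> \<open>every frequency \<open>i * (N div j)\<close> is at most \<open>M * N\<close>, so a cutoff there keeps the whole polynomial\<close>
  define L where "L = M * N"
  have le: "i * (N div j) \<le> L" if "i \<le> M" for i j
    unfolding L_def using that by (intro mult_le_mono) auto
  have 0: "hilbert_coeff M N n = 0" if "n > L" for n
  proof -
    have "{(i, j). i \<in> {1..M} \<and> j \<in> {1..M} \<and> i * (N div j) = n} = {}"
      using le that by (auto simp: not_le[symmetric])
    then show ?thesis unfolding hilbert_coeff_def by (simp only: sum.empty)
  qed
  have "(\<lambda>n. hilbert_coeff M N (Suc n) * of_nat (Suc n) powr (-s)) sums
      (\<Sum>n<L. hilbert_coeff M N (Suc n) * of_nat (Suc n) powr (-s))"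
    by (rule sums_finite) (auto simp: 0)
  also have "(\<Sum>n<L. hilbert_coeff M N (Suc n) * of_nat (Suc n) powr (-s)) =
      (\<Sum>n=1..L. hilbert_coeff M N n * of_nat n powr (-s))"
    by (rule sum.reindex_bij_witness[of _ "\<lambda>n. n - 1" Suc]) auto
  also have "\<dots> = hilbert_poly M N s"
    unfolding hilbert_coeff_sum[OF assms] hilbert_poly_def
    by (intro sum.cong refl) (simp add: le)
  finally show "(\<lambda>n. hilbert_coeff M N (Suc n) * of_nat (Suc n) powr (-s)) sums hilbert_poly M N s" .
qed simp

lemma norm_of_nat_powr_le_1:
  assumes "s \<in> half_plane 0"
  shows "norm (of_nat n powr (-s) :: complex) \<le> 1"
proof (cases "n = 0")
  case False
  then have "norm (of_nat n powr (-s) :: complex) = real n powr (- Re s)"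
    by (simp add: norm_of_nat_powr)
  also have "\<dots> \<le> real n powr 0"
    using assms False by (intro powr_mono) (auto simp: half_plane_def)
  finally show ?thesis using False by simp
qed simp

text \<open>
  Hilbert's inequality applies pointwise, since the entries \<open>i\<^bsup>-s\<^esup>\<close> and \<open>\<lfloor>N/j\<rfloor>\<^bsup>-s\<^esup>\<close> lie in the unit disc.
\<close>

lemma norm_hilbert_poly_le:
  assumes "s \<in> half_plane 0"
  shows "norm (hilbert_poly M N s) \<le> pi * real M"
proof -
  have "(\<Sum>i=1..M. (norm (x i :: complex))\<^sup>2) \<le> real M" if "\<And>i. norm (x i) \<le> 1" for x
  proof -
    have "(\<Sum>i=1..M. (norm (x i))\<^sup>2) \<le> (\<Sum>i=1..M. 1)"
      using that by (intro sum_mono) (simp add: abs_square_le_1)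
    then show ?thesis by simp
  qed
  note sq = this
  have "norm (hilbert_poly M N s) \<le> pi / 2 *
      ((\<Sum>i=1..M. (norm (of_nat i powr (-s) :: complex))\<^sup>2) + (\<Sum>j=1..M. (norm (of_nat (N div j) powr (-s) :: complex))\<^sup>2))"
    unfolding hilbert_poly_def by (rule hilbert_inequality) simp
  also have "\<dots> \<le> pi / 2 * (real M + real M)"
    using assms by (intro mult_left_mono add_mono sq norm_of_nat_powr_le_1) auto
  finally show ?thesis by simp
qed

lemma dirichlet_rep_cmult:
  assumes "dirichlet_rep a f"
  shows "dirichlet_rep (\<lambda>n. c * a n) (\<lambda>s. c * f s)"
proof -
  obtain \<sigma> where "\<sigma> > 0"
    "\<And>s. s \<in> half_plane \<sigma> \<Longrightarrow> (\<lambda>n. a (Suc n) * of_nat (Suc n) powr (-s)) sums f s"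
    using assms unfolding dirichlet_rep_def by blast
  then show ?thesis
    unfolding dirichlet_rep_def using sums_mult[of _ _ c] by (metis (no_types, lifting) mult.assoc sums_cong)
qed

text \<open>
  The Hilbert polynomial has norm at most \<open>\<pi> M\<close>. Its \<open>N\<close>-th partial sum is the upper triangular part of the
  form, which at \<open>s = 0\<close> has only positive terms and is at least \<open>M (ln M - 1)\<close>. The origin lies on the boundary of the
  half-plane and is reached as a limit.
\<close>

lemma Hinf_opnorm_lower:
  fixes M N :: nat
  assumes M: "M \<ge> 1" "M * M \<le> N"
  shows "Hinf_opnorm (partial_sum_op N) \<ge> ereal ((ln (real M) - 1) / pi)"
proof -
  define c :: complex where "c = 1 / of_real (pi * real M)"
  define f where "f = (\<lambda>s. c * hilbert_poly M N s)"
  have norm_c: "norm c = 1 / (pi * real M)" by (simp add: c_def norm_divide norm_mult)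
  have N: "N \<ge> 1" using M by (metis le_trans le_square)
  have rep: "dirichlet_rep (\<lambda>n. c * hilbert_coeff M N n) f"
    unfolding f_def by (rule dirichlet_rep_cmult[OF hilbert_poly_dirichlet_rep[OF M(2)]])
  have bd: "norm (f s) \<le> 1" if "s \<in> half_plane 0" for s
    using norm_hilbert_poly_le[OF that, of M N] M by (simp add: f_def norm_mult norm_c field_simps)
  have Npos: "N div j \<noteq> 0" if "j \<in> {1..M}" for j
  proof -
    have "j \<le> M * M" using that by (metis atLeastAtMost_iff le_square le_trans)
    then show ?thesis using that M by (simp add: div_eq_0_iff)
  qed
  have "f holomorphic_on half_plane 0"
    unfolding f_def hilbert_poly_def divide_inverse using Npos by (intro holomorphic_intros) auto
  then have f: "f \<in> Hinf"
    using rep bd unfolding Hinf_def by (auto simp: bounded_iff)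
  have "Hinf_norm f \<le> 1"
    unfolding Hinf_norm_def using bd by (intro SUP_least) (simp add: one_ereal_def)
  with f have op: "Hinf_norm (partial_sum_op N f) \<le> Hinf_opnorm (partial_sum_op N)"
    unfolding Hinf_opnorm_def by (intro SUP_upper) auto
  define P where "P = (\<lambda>s. c * (\<Sum>i=1..M. \<Sum>j=1..M. if i \<le> j
        then of_nat i powr (-s) * of_nat (N div j) powr (-s) / of_int (int j - int i) else 0))"
  have P: "partial_sum_op N f s = P s" if "s \<in> half_plane 0" for s
  proof -
    have "partial_sum_op N f s = c * (\<Sum>n=1..N. hilbert_coeff M N n * of_nat n powr (-s))"
      by (simp add: partial_sum_op_eq[OF f rep N that] sum_distrib_left mult_ac)
    also have "\<dots> = P s"
      unfolding hilbert_coeff_sum[OF M(2)] P_def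
      by (intro arg_cong[of _ _ "(*) c"] sum.cong refl if_cong hyperbola_truncation_iff)
         (use M in auto)
    finally show ?thesis .
  qed
  have cont: "isCont P 0"
  proof -
    have "isCont (\<lambda>s. if i \<le> j then of_nat i powr (-s) * of_nat (N div j) powr (-s) / of_int (int j - int i) else 0 :: complex) 0"
      if "i \<in> {1..M}" "j \<in> {1..M}" for i j
      using that Npos[of j] unfolding divide_inverse
      by (cases "i \<le> j") (auto intro!: continuous_intros)
    then show ?thesis
      unfolding P_def by (intro continuous_intros) auto
  qed
  have "ereal (norm (P 0)) \<le> Hinf_opnorm (partial_sum_op N)"
  proof (rule tendsto_upperbound)
    have "(\<lambda>n. complex_of_real (1 / real (Suc n))) \<longlonglongrightarrow> of_real 0"
      by (intro tendsto_of_real LIMSEQ_Suc lim_1_over_n)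
    then have "(\<lambda>n. complex_of_real (1 / real (Suc n))) \<longlonglongrightarrow> 0" by simp
    then show "(\<lambda>n. ereal (norm (P (of_real (1 / real (Suc n)))))) \<longlonglongrightarrow> ereal (norm (P 0))"
      by (intro tendsto_intros isCont_tendsto_compose[OF cont])
    show "\<forall>\<^sub>F n in sequentially. ereal (norm (P (of_real (1 / real (Suc n))))) \<le> Hinf_opnorm (partial_sum_op N)"
    proof (intro always_eventually allI)
      fix n
      define s where "s = complex_of_real (1 / real (Suc n))"
      have s: "s \<in> half_plane 0" by (simp add: s_def half_plane_def)
      have "ereal (norm (partial_sum_op N f s)) \<le> Hinf_norm (partial_sum_op N f)"
        unfolding Hinf_norm_def using s by (rule SUP_upper)
      then show "ereal (norm (P (of_real (1 / real (Suc n))))) \<le> Hinf_opnorm (partial_sum_op N)"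
        using op P[OF s] unfolding s_def by (metis order_trans)
    qed
  qed simp
  moreover have "(ln (real M) - 1) / pi \<le> norm (P 0)"
  proof -
    define T where "T = (\<Sum>i=1..M. \<Sum>j=1..M. if i < j then 1 / (real j - real i) else 0)"
    have "P 0 = c * of_real T"
      unfolding P_def T_def of_real_sum
    proof (intro arg_cong[of _ _ "(*) c"] sum.cong refl)
      fix i j assume "i \<in> {1..M}" "j \<in> {1..M}"
      with Npos[of j] show "(if i \<le> j then of_nat i powr (-0) * of_nat (N div j) powr (-0) / of_int (int j - int i) else 0)
          = complex_of_real (if i < j then 1 / (real j - real i) else 0)"
        by auto
    qed
    then have "norm (P 0) = \<bar>T\<bar> / (pi * real M)"
      by (simp add: norm_mult norm_c)
    moreover have "real M * (ln (real M) - 1) \<le> T"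
      unfolding T_def using M(1) by (rule truncated_hilbert_sum)
    then have "real M * (ln (real M) - 1) / (pi * real M) \<le> \<bar>T\<bar> / (pi * real M)"
      by (intro divide_right_mono) auto
    ultimately show ?thesis using M by simp
  qed
  ultimately show ?thesis
    using ereal_less_eq(3) order_trans by blast
qed

lemma Hinf_opnorm_lower_sqrt:
  "\<forall>\<^sub>F N in sequentially. Hinf_opnorm (partial_sum_op N) \<ge> ereal ((ln (sqrt (real N) - 1) - 1) / pi)"
  using eventually_gt_at_top[of 1]
proof eventually_elim
  case (elim N)
  define M where "M = nat \<lfloor>sqrt (real N)\<rfloor>"
  have s: "sqrt (real N) > 1" using elim by simp
  have M: "real M \<le> sqrt (real N)" "sqrt (real N) - 1 < real M" "M \<ge> 1"
    unfolding M_def using s by linarith+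
  have "real M * real M \<le> sqrt (real N) * sqrt (real N)"
    using M by (intro mult_mono) auto
  then have "real (M * M) \<le> real N" by simp
  then have "M * M \<le> N" by (simp only: of_nat_le_iff)
  with M(3) have "ereal ((ln (real M) - 1) / pi) \<le> Hinf_opnorm (partial_sum_op N)"
    by (rule Hinf_opnorm_lower)
  moreover have "(ln (sqrt (real N) - 1) - 1) / pi \<le> (ln (real M) - 1) / pi"
  proof -
    have "0 < sqrt (real N) - 1" using s by linarith
    then have "ln (sqrt (real N) - 1) \<le> ln (real M)" using M(2) by (intro ln_mono) auto
    then show ?thesis by (intro divide_right_mono) auto
  qed
  ultimately show ?case
    using ereal_less_eq(3) order_trans by blast
qed

text \<open>
  The choice \<open>M = \<lfloor>\<surd>N\<rfloor>\<close> is what produces \<open>1/(2\<pi>)\<close>: the factor \<open>1/2\<close> is \<open>ln M / ln N\<close>, and \<open>1/\<pi>\<close> comes from the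
  constant in Hilbert's inequality.
\<close>

theorem theorem1p1:
  "liminf (\<lambda>N. Hinf_opnorm (partial_sum_op N) / ereal (ln (real N))) \<ge> ereal (1 / (2 * pi)) \<and>
   (\<exists>c C :: real. 0 < c \<and> c \<le> C \<and>
     (\<forall>\<^sub>F N in sequentially.
        ereal (c * ln (real N)) \<le> Hinf_opnorm (partial_sum_op N) \<and>
        Hinf_opnorm (partial_sum_op N) \<le> ereal (C * ln (real N))))"
proof (intro conjI exI)
  define g where "g = (\<lambda>N. (ln (sqrt (real N) - 1) - 1) / pi)"
  have "(\<lambda>N. g N / ln (real N)) \<longlonglongrightarrow> 1 / (2 * pi)"
  proof -
    have "(\<lambda>N. (ln (sqrt (real N) - 1) - 1) / ln (real N)) \<longlonglongrightarrow> 1 / 2"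
      by real_asymp
    then have "(\<lambda>N. (ln (sqrt (real N) - 1) - 1) / ln (real N) / pi) \<longlonglongrightarrow> 1 / 2 / pi"
      by (rule tendsto_divide) auto
    then show ?thesis by (simp add: g_def mult_ac)
  qed
  then have "(\<lambda>N. ereal (g N / ln (real N))) \<longlonglongrightarrow> ereal (1 / (2 * pi))"
    by (rule tendsto_ereal)
  then have "ereal (1 / (2 * pi)) = liminf (\<lambda>N. ereal (g N / ln (real N)))"
    by (intro lim_imp_Liminf[symmetric]) auto
  also have "\<dots> \<le> liminf (\<lambda>N. Hinf_opnorm (partial_sum_op N) / ereal (ln (real N)))"
  proof (rule Liminf_mono)
    show "\<forall>\<^sub>F N in sequentially. ereal (g N / ln (real N)) \<le> Hinf_opnorm (partial_sum_op N) / ereal (ln (real N))"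
      using Hinf_opnorm_lower_sqrt eventually_gt_at_top[of 1]
    proof eventually_elim
      case (elim N)
      then have "ln (real N) > 0" by simp
      then show ?case
        using elim(1) ereal_divide_right_mono[of "ereal (g N)" _ "ereal (ln (real N))"]
        by (simp add: g_def)
    qed
  qed
  finally show "ereal (1 / (2 * pi)) \<le> liminf (\<lambda>N. Hinf_opnorm (partial_sum_op N) / ereal (ln (real N)))" .
  have "\<forall>\<^sub>F N in sequentially. ln (real N) / 4 \<le> ln (sqrt (real N) - 1) - 1"
    by real_asymp
  then have "\<forall>\<^sub>F N in sequentially. 1 / (4 * pi) * ln (real N) \<le> g N"
    unfolding g_def by eventually_elim (simp add: field_simps)
  then show "\<forall>\<^sub>F N in sequentially.
      ereal (1 / (4 * pi) * ln (real N)) \<le> Hinf_opnorm (partial_sum_op N) \<and>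
      Hinf_opnorm (partial_sum_op N) \<le> ereal (7 * ln (real N))"
    using Hinf_opnorm_lower_sqrt Hinf_opnorm_upper
  proof eventually_elim
    case (elim N)
    then show ?case
      using order_trans[of "ereal (1 / (4 * pi) * ln (real N))" "ereal (g N)"] by (simp add: g_def)
  qed
  show "0 < 1 / (4 * pi)" by simp
  have "1 / (4 * pi) \<le> 1 / 4" using pi_ge_two by (simp add: field_simps)
  then show "1 / (4 * pi) \<le> 7" by linarith
qed

end
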